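(* Every sequence of functions in $L_0(\ell_1)$ that is scalarly null in measure contains a subsequence that is scalarly null a.e. In particular, $\ell_1$ satisfies property $(D_p)$ for each $1\le p\le\infty$: every $L_p(\ell_1)$-bounded sequence of functions that converges scalarly in measure (to some $f\in L_0(\ell_1)$) has a subsequence that converges scalarly a.e.
   Context: $(\Omega,\Sigma,\mu)$ is the Lebesgue measure space on $[0,1]$. Banach spaces are real. For a Banach space $X$, $L_0(X)$ is the space of (classes of a.e. equal) strongly measurable functions $f:\Omega\to X$, and $L_p(X)$ are the Bochner–Lebesgue spaces. For $f_n,f\in L_0(X)$, $\{f_n\}$ converges scalarly a.e. (resp. scalarly in measure) to $f$ if for each $x^*\in X^*$, $x^*f_n\to x^*f$ almost everywhere, with exceptional null set possibly depending on $x^*$ (resp. in measure). $\{f_n\}$ is scalarly null a.e. (resp. in measure) if this holds with $f=0$. A sequence is $L_p(X)$-bounded if $\sup_n\|f_n\|_{L_p(X)}<\infty$. *)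

theory Defs
  imports "HOL-Probability.Essential_Supremum"
begin

section \<open>The Banach space of absolutely summable real sequences\<close>

typedef ell1 = "{x :: nat \<Rightarrow> real. summable (\<lambda>i. \<bar>x i\<bar>)}"
  morphisms ell1_nth Abs_ell1
  by (rule exI[of _ "\<lambda>_. 0"]) simp

setup_lifting type_definition_ell1

lemma ell1_eqI: "(\<And>i. ell1_nth x i = ell1_nth y i) \<Longrightarrow> x = y"
  by transfer auto

lemma summable_ell1: "summable (\<lambda>i. \<bar>ell1_nth x i\<bar>)"
  using ell1_nth by simp

lemma abs_summable_add:
  fixes x y :: "nat \<Rightarrow> real"
  assumes "summable (\<lambda>i. \<bar>x i\<bar>)" "summable (\<lambda>i. \<bar>y i\<bar>)"
  shows "summable (\<lambda>i. \<bar>x i + y i\<bar>)"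
  by (rule summable_comparison_test'[OF summable_add[OF assms], of 0]) auto

lemma abs_summable_diff:
  fixes x y :: "nat \<Rightarrow> real"
  assumes "summable (\<lambda>i. \<bar>x i\<bar>)" "summable (\<lambda>i. \<bar>y i\<bar>)"
  shows "summable (\<lambda>i. \<bar>x i - y i\<bar>)"
  using abs_summable_add[of x "\<lambda>i. - y i"] assms by simp

instantiation ell1 :: real_normed_vector
begin

lift_definition zero_ell1 :: ell1 is "\<lambda>_. 0"
  by simp

lift_definition plus_ell1 :: "ell1 \<Rightarrow> ell1 \<Rightarrow> ell1" is "\<lambda>x y i. x i + y i"
  using abs_summable_add by simp

lift_definition uminus_ell1 :: "ell1 \<Rightarrow> ell1" is "\<lambda>x i. - x i"
  by simp

lift_definition minus_ell1 :: "ell1 \<Rightarrow> ell1 \<Rightarrow> ell1" is "\<lambda>x y i. x i - y i"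
  using abs_summable_diff by simp

lift_definition scaleR_ell1 :: "real \<Rightarrow> ell1 \<Rightarrow> ell1" is "\<lambda>c x i. c * x i"
  by (simp add: abs_mult summable_mult)

lift_definition norm_ell1 :: "ell1 \<Rightarrow> real" is "\<lambda>x. \<Sum>i. \<bar>x i\<bar>" .

definition dist_ell1 :: "ell1 \<Rightarrow> ell1 \<Rightarrow> real"
  where "dist_ell1 x y = norm (x - y)"

definition sgn_ell1 :: "ell1 \<Rightarrow> ell1"
  where "sgn_ell1 x = scaleR (inverse (norm x)) x"

definition uniformity_ell1 :: "(ell1 \<times> ell1) filter"
  where "uniformity_ell1 = (INF e\<in>{0 <..}. principal {(x, y). dist x y < e})"

definition open_ell1 :: "ell1 set \<Rightarrow> bool"
  where "open_ell1 S = (\<forall>x\<in>S. \<forall>\<^sub>F (x', y) in uniformity. x' = x \<longrightarrow> y \<in> S)"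

instance
proof
  fix x y :: ell1 and a :: real
  show "(norm x = 0) = (x = 0)"
    by (auto simp: norm_ell1.rep_eq suminf_eq_zero_iff summable_ell1 zero_ell1.rep_eq intro!: ell1_eqI)
  show "norm (x + y) \<le> norm x + norm y"
  proof -
    have "norm (x + y) \<le> (\<Sum>i. \<bar>ell1_nth x i\<bar> + \<bar>ell1_nth y i\<bar>)"
      unfolding norm_ell1.rep_eq
      by (rule suminf_le)
        (auto simp: plus_ell1.rep_eq abs_triangle_ineq abs_summable_add summable_ell1
          intro: summable_add)
    then show ?thesis
      by (simp add: norm_ell1.rep_eq suminf_add summable_ell1)
  qed
  show "norm (a *\<^sub>R x) = \<bar>a\<bar> * norm x"
    by (simp add: norm_ell1.rep_eq scaleR_ell1.rep_eq abs_mult suminf_mult summable_ell1)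
qed (auto simp: dist_ell1_def sgn_ell1_def uniformity_ell1_def open_ell1_def
      plus_ell1.rep_eq minus_ell1.rep_eq uminus_ell1.rep_eq zero_ell1.rep_eq
      scaleR_ell1.rep_eq algebra_simps intro!: ell1_eqI)

end

lemma sum_le_norm_ell1: "(\<Sum>i<k. \<bar>ell1_nth x i\<bar>) \<le> norm x"
  unfolding norm_ell1.rep_eq by (rule sum_le_suminf) (auto simp: summable_ell1)

lemma abs_nth_le_norm_ell1: "\<bar>ell1_nth x i\<bar> \<le> norm x"
proof -
  have "\<bar>ell1_nth x i\<bar> \<le> (\<Sum>j<Suc i. \<bar>ell1_nth x j\<bar>)"
    by (rule member_le_sum) auto
  then show ?thesis
    using sum_le_norm_ell1[where k = "Suc i" and x = x] by linarith
qed

instance ell1 :: banach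
proof
  fix X :: "nat \<Rightarrow> ell1"
  assume X: "Cauchy X"
  have "Cauchy (\<lambda>n. ell1_nth (X n) i)" for i
  proof (rule CauchyI)
    fix e :: real assume "e > 0"
    then obtain N where N: "\<And>m n. m \<ge> N \<Longrightarrow> n \<ge> N \<Longrightarrow> norm (X m - X n) < e"
      using CauchyD[OF X] by blast
    have "norm (ell1_nth (X m) i - ell1_nth (X n) i) < e" if "m \<ge> N" "n \<ge> N" for m n
      using N[OF that] abs_nth_le_norm_ell1[of "X m - X n" i] by (simp add: minus_ell1.rep_eq)
    then show "\<exists>N. \<forall>m\<ge>N. \<forall>n\<ge>N. norm (ell1_nth (X m) i - ell1_nth (X n) i) < e"
      by blast
  qed
  then have "\<exists>l. (\<lambda>n. ell1_nth (X n) i) \<longlonglongrightarrow> l" for i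
    by (simp add: Cauchy_convergent_iff convergent_def)
  then obtain y where y: "\<And>i. (\<lambda>n. ell1_nth (X n) i) \<longlonglongrightarrow> y i"
    by metis
  have bound: "(\<Sum>i<k. \<bar>ell1_nth (X m) i - y i\<bar>) \<le> e"
    if N: "\<And>m n. m \<ge> N \<Longrightarrow> n \<ge> N \<Longrightarrow> norm (X m - X n) < e" and "m \<ge> N" for e N m k
  proof (rule tendsto_upperbound)
    show "(\<lambda>n. \<Sum>i<k. \<bar>ell1_nth (X m) i - ell1_nth (X n) i\<bar>)
            \<longlonglongrightarrow> (\<Sum>i<k. \<bar>ell1_nth (X m) i - y i\<bar>)"
      by (intro tendsto_intros y)
    have "(\<Sum>i<k. \<bar>ell1_nth (X m) i - ell1_nth (X n) i\<bar>) \<le> e" if "n \<ge> N" for n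
      using N[OF \<open>m \<ge> N\<close> that] sum_le_norm_ell1[of "X m - X n" k]
      by (simp add: minus_ell1.rep_eq)
    then show "\<forall>\<^sub>F n in sequentially. (\<Sum>i<k. \<bar>ell1_nth (X m) i - ell1_nth (X n) i\<bar>) \<le> e"
      by (auto simp: eventually_sequentially)
  qed simp
  have diff: "summable (\<lambda>i. \<bar>ell1_nth (X m) i - y i\<bar>)"
             "(\<Sum>i. \<bar>ell1_nth (X m) i - y i\<bar>) \<le> e"
    if N: "\<And>m n. m \<ge> N \<Longrightarrow> n \<ge> N \<Longrightarrow> norm (X m - X n) < e" and "m \<ge> N" for e N m
  proof -
    show s: "summable (\<lambda>i. \<bar>ell1_nth (X m) i - y i\<bar>)"
      by (rule summableI_nonneg_bounded[where x = e]) (use bound[OF that] in auto)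
    show "(\<Sum>i. \<bar>ell1_nth (X m) i - y i\<bar>) \<le> e"
      by (rule suminf_le_const[OF s]) (use bound[OF that] in auto)
  qed
  have "summable (\<lambda>i. \<bar>y i\<bar>)"
  proof -
    obtain N where "\<And>m n. m \<ge> N \<Longrightarrow> n \<ge> N \<Longrightarrow> norm (X m - X n) < 1"
      using CauchyD[OF X, of 1] by auto
    then have "summable (\<lambda>i. \<bar>ell1_nth (X N) i - y i\<bar>)"
      using diff(1)[of N 1 N] by auto
    from summable_add[OF this summable_ell1[of "X N"]] show ?thesis
      by (rule summable_comparison_test') auto
  qed
  then have nth: "ell1_nth (Abs_ell1 y) = y"
    by (simp add: Abs_ell1_inverse)
  have "X \<longlonglongrightarrow> Abs_ell1 y"
  proof (rule LIMSEQ_I)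
    fix e :: real assume "e > 0"
    then obtain N where N: "\<And>m n. m \<ge> N \<Longrightarrow> n \<ge> N \<Longrightarrow> norm (X m - X n) < e / 2"
      using CauchyD[OF X, of "e / 2"] by auto
    have "norm (X m - Abs_ell1 y) < e" if "m \<ge> N" for m
      using diff(2)[OF N that] \<open>e > 0\<close>
      by (simp add: norm_ell1.rep_eq minus_ell1.rep_eq nth)
    then show "\<exists>N. \<forall>m\<ge>N. norm (X m - Abs_ell1 y) < e"
      by blast
  qed
  then show "convergent X"
    by (auto simp: convergent_def)
qed


section \<open>Vector-valued functions\<close>

text \<open>Elements of \<open>L\<^sub>0(X)\<close> are represented by functions rather than by classes of
  a.e. equal functions; all notions below are invariant under a.e. modification on a complete
  measure space.\<close>

definition L0 :: "'a measure \<Rightarrow> ('a \<Rightarrow> 'b::real_normed_vector) set" where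
  "L0 M = {f. \<exists>s :: nat \<Rightarrow> 'a \<Rightarrow> 'b. (\<forall>n. simple_function M (s n)) \<and>
                (AE x in M. (\<lambda>n. s n x) \<longlonglongrightarrow> f x)}"

text \<open>The case \<open>I = \<infinity>\<close> is separated because \<open>powr\<close> is not defined on extended reals.\<close>

definition Lp_norm :: "ennreal \<Rightarrow> 'a measure \<Rightarrow> ('a \<Rightarrow> 'b::real_normed_vector) \<Rightarrow> ennreal" where
  "Lp_norm p M f =
     (if p = \<infinity> then esssup M (\<lambda>x. ennreal (norm (f x)))
      else let I = \<integral>\<^sup>+ x. ennreal (norm (f x) powr enn2real p) \<partial>M
           in if I = \<infinity> then \<infinity> else ennreal (enn2real I powr (1 / enn2real p)))"

definition Lp_bounded :: "ennreal \<Rightarrow> 'a measure \<Rightarrow> (nat \<Rightarrow> 'a \<Rightarrow> 'b::real_normed_vector) \<Rightarrow> bool" where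
  "Lp_bounded p M f \<longleftrightarrow> (\<forall>n. f n \<in> L0 M) \<and> (SUP n. Lp_norm p M (f n)) < \<infinity>"

definition tendsto_in_measure ::
    "'a measure \<Rightarrow> (nat \<Rightarrow> 'a \<Rightarrow> real) \<Rightarrow> ('a \<Rightarrow> real) \<Rightarrow> bool" where
  "tendsto_in_measure M g h \<longleftrightarrow>
     (\<forall>\<epsilon>>0. (\<lambda>n. emeasure M {x \<in> space M. \<epsilon> \<le> \<bar>g n x - h x\<bar>}) \<longlonglongrightarrow> 0)"

definition scalarly_converges_ae ::
    "'a measure \<Rightarrow> (nat \<Rightarrow> 'a \<Rightarrow> 'b::real_normed_vector) \<Rightarrow> ('a \<Rightarrow> 'b) \<Rightarrow> bool" where
  "scalarly_converges_ae M f g \<longleftrightarrow>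
     (\<forall>\<phi> :: 'b \<Rightarrow>\<^sub>L real. AE x in M. (\<lambda>n. blinfun_apply \<phi> (f n x)) \<longlonglongrightarrow> blinfun_apply \<phi> (g x))"

definition scalarly_converges_in_measure ::
    "'a measure \<Rightarrow> (nat \<Rightarrow> 'a \<Rightarrow> 'b::real_normed_vector) \<Rightarrow> ('a \<Rightarrow> 'b) \<Rightarrow> bool" where
  "scalarly_converges_in_measure M f g \<longleftrightarrow>
     (\<forall>\<phi> :: 'b \<Rightarrow>\<^sub>L real.
        tendsto_in_measure M (\<lambda>n x. blinfun_apply \<phi> (f n x)) (\<lambda>x. blinfun_apply \<phi> (g x)))"

abbreviation scalarly_null_ae ::
    "'a measure \<Rightarrow> (nat \<Rightarrow> 'a \<Rightarrow> 'b::real_normed_vector) \<Rightarrow> bool" where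
  "scalarly_null_ae M f \<equiv> scalarly_converges_ae M f (\<lambda>_. 0)"

abbreviation scalarly_null_in_measure ::
    "'a measure \<Rightarrow> (nat \<Rightarrow> 'a \<Rightarrow> 'b::real_normed_vector) \<Rightarrow> bool" where
  "scalarly_null_in_measure M f \<equiv> scalarly_converges_in_measure M f (\<lambda>_. 0)"

abbreviation Omega :: "real measure" where
  "Omega \<equiv> lebesgue_on {0..1}"

text \<open>The Banach space is passed as a type. The scalar a.e. limit of the subsequence is required
  to be the given limit in measure; any scalar a.e. limit in \<open>L\<^sub>0(X)\<close> is a.e. equal to it.\<close>

definition property_D :: "ennreal \<Rightarrow> 'b::banach itself \<Rightarrow> bool" where
  "property_D p _ \<longleftrightarrow>
     (\<forall>(f :: nat \<Rightarrow> real \<Rightarrow> 'b) g.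
        Lp_bounded p Omega f \<and> g \<in> L0 Omega \<and> scalarly_converges_in_measure Omega f g \<longrightarrow>
        (\<exists>r :: nat \<Rightarrow> nat. strict_mono r \<and> scalarly_converges_ae Omega (f \<circ> r) g))"

end

(* The functionals act on f_n uniformly: sup over the unit ball of the dual of
   mu(|phi f_n| >= eps) tends to 0. If not, a gliding hump applies. Along a subsequence f_{n_k} is,
   up to small measure, concentrated on coordinate blocks that are disjoint, and functionals
   supported on these blocks glue to one element of l_infinity that contradicts scalar convergence
   in measure. Hence there are r_k with mu(|phi f_{r_k}| >= 2^-k) <= 2^-k for all phi in the ball,
   and Borel-Cantelli gives a.e. convergence for each phi. *)

theory Submission
  imports Defs
begin

section \<open>Coordinates and functionals on the sequence space\<close>

lift_definition ell1_unit :: "nat \<Rightarrow> ell1" is "\<lambda>i j. if j = i then 1 else (0::real)"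
  by (rule summable_finite[of "{_}"]) auto

lemma ell1_nth_sum: "ell1_nth (\<Sum>a\<in>A. g a) i = (\<Sum>a\<in>A. ell1_nth (g a) i)"
  by (induction A rule: infinite_finite_induct) (auto simp: zero_ell1.rep_eq plus_ell1.rep_eq)

text \<open>Removing the coordinates in \<open>A\<close> splits \<open>x\<close> into two vectors
  with disjoint supports, and the ell1 norm is additive over disjoint supports.\<close>

lemma norm_minus_block:
  assumes "finite A"
  shows "norm (x - (\<Sum>i\<in>A. ell1_nth x i *\<^sub>R ell1_unit i)) = norm x - (\<Sum>i\<in>A. \<bar>ell1_nth x i\<bar>)"
proof -
  define z where "z = x - (\<Sum>i\<in>A. ell1_nth x i *\<^sub>R ell1_unit i)"
  have z: "ell1_nth z j = (if j \<in> A then 0 else ell1_nth x j)" for j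
    using assms
    by (simp add: z_def minus_ell1.rep_eq ell1_nth_sum scaleR_ell1.rep_eq ell1_unit.rep_eq if_distrib
        cong: if_cong)
  define h where "h j = (if j \<in> A then \<bar>ell1_nth x j\<bar> else 0)" for j
  have h: "summable h" "suminf h = (\<Sum>i\<in>A. \<bar>ell1_nth x i\<bar>)"
    using summable_finite[OF assms, of h] suminf_finite[OF assms, of h] by (auto simp: h_def)
  have "norm x = (\<Sum>j. \<bar>ell1_nth z j\<bar> + h j)"
    unfolding norm_ell1.rep_eq by (rule suminf_cong) (simp add: z h_def)
  also have "\<dots> = norm z + suminf h"
    unfolding norm_ell1.rep_eq by (rule suminf_add[symmetric]) (fact summable_ell1 h(1))+
  finally show ?thesis
    by (simp add: h z_def)
qed

lemma bounded_linear_ell1_nth: "bounded_linear (\<lambda>x. ell1_nth x i)"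
  by (rule bounded_linear_intro[where K = 1])
    (auto simp: plus_ell1.rep_eq scaleR_ell1.rep_eq abs_nth_le_norm_ell1)

lemma tail_tendsto_0: "(\<lambda>N. norm x - (\<Sum>i<N. \<bar>ell1_nth x i\<bar>)) \<longlonglongrightarrow> 0"
  using tendsto_diff[OF tendsto_const[of "norm x"] summable_LIMSEQ[OF summable_ell1[of x]]]
  by (simp add: norm_ell1.rep_eq)

text \<open>The difference \<open>\<phi> - \<psi>\<close> kills the unit vectors of the block from
  \<open>a\<close> to \<open>b\<close>, so it sees only \<open>x\<close> with this block removed. By
  additivity the norm of that remainder is the head below \<open>a\<close> plus the tail from
  \<open>b\<close> on.\<close>

lemma blinfun_diff_le:
  fixes \<phi> \<psi> :: "ell1 \<Rightarrow>\<^sub>L real"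
  assumes "a \<le> b" "\<And>i. a \<le> i \<Longrightarrow> i < b \<Longrightarrow> \<phi> (ell1_unit i) = \<psi> (ell1_unit i)"
  shows "\<bar>\<phi> x - \<psi> x\<bar> \<le> norm (\<phi> - \<psi>) *
    ((\<Sum>i<a. \<bar>ell1_nth x i\<bar>) + (norm x - (\<Sum>i<b. \<bar>ell1_nth x i\<bar>)))"
proof -
  define u where "u = (\<Sum>i\<in>{a..<b}. ell1_nth x i *\<^sub>R ell1_unit i)"
  have "(\<phi> - \<psi>) u = 0"
    by (simp add: u_def blinfun.sum_right blinfun.scaleR_right blinfun.diff_left assms(2)
        del: sum.op_ivl_Suc)
  then have "\<bar>\<phi> x - \<psi> x\<bar> = norm ((\<phi> - \<psi>) (x - u))"
    by (simp add: blinfun.diff_left blinfun.diff_right)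
  also have "\<dots> \<le> norm (\<phi> - \<psi>) * norm (x - u)"
    by (rule norm_blinfun)
  also have "norm (x - u) = norm x - (\<Sum>i\<in>{a..<b}. \<bar>ell1_nth x i\<bar>)"
    unfolding u_def by (rule norm_minus_block) simp
  also have "(\<Sum>i\<in>{a..<b}. \<bar>ell1_nth x i\<bar>) = (\<Sum>i<b. \<bar>ell1_nth x i\<bar>) - (\<Sum>i<a. \<bar>ell1_nth x i\<bar>)"
    using sum_diff_nat_ivl[of 0 a b "\<lambda>i. \<bar>ell1_nth x i\<bar>"] assms(1)
    by (simp add: atLeast0LessThan)
  finally show ?thesis
    by (simp add: algebra_simps)
qed

text \<open>Pairing with a bounded sequence. This half of the duality between ell1 and the bounded
  sequences allows functionals to be glued coordinate by coordinate.\<close>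

lemma ex_blinfun_ell1_unit:
  fixes y :: "nat \<Rightarrow> real"
  assumes y: "\<And>i. \<bar>y i\<bar> \<le> 1"
  obtains \<psi> :: "ell1 \<Rightarrow>\<^sub>L real" where "norm \<psi> \<le> 1" "\<And>i. \<psi> (ell1_unit i) = y i"
proof -
  define F where "F x = (\<Sum>i. y i * ell1_nth x i)" for x
  have le: "\<bar>y i * ell1_nth x i\<bar> \<le> \<bar>ell1_nth x i\<bar>" for i x
    using mult_right_mono[OF y[of i], of "\<bar>ell1_nth x i\<bar>"] by (simp add: abs_mult)
  have s': "summable (\<lambda>i. \<bar>y i * ell1_nth x i\<bar>)" for x
    by (rule summable_comparison_test'[OF summable_ell1[of x], of 0]) (use le in auto)
  then have s: "summable (\<lambda>i. y i * ell1_nth x i)" for x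
    by (rule summable_rabs_cancel)
  have F: "\<bar>F x\<bar> \<le> norm x" for x
  proof -
    have "\<bar>F x\<bar> \<le> (\<Sum>i. \<bar>y i * ell1_nth x i\<bar>)"
      unfolding F_def by (rule summable_rabs[OF s'])
    also have "\<dots> \<le> norm x"
      unfolding norm_ell1.rep_eq by (rule suminf_le[OF le s' summable_ell1])
    finally show ?thesis .
  qed
  have bl: "bounded_linear F"
  proof (rule bounded_linear_intro[where K = 1])
    show "F (x + z) = F x + F z" for x z
      unfolding F_def plus_ell1.rep_eq
      by (subst suminf_add[OF s s]) (simp add: algebra_simps)
    show "F (r *\<^sub>R x) = r *\<^sub>R F x" for r x
      unfolding F_def scaleR_ell1.rep_eq real_scaleR_def
      by (subst suminf_mult[OF s, symmetric]) (simp add: algebra_simps)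
  qed (use F in simp)
  show ?thesis
  proof
    show "norm (Blinfun F) \<le> 1"
      by (rule norm_blinfun_bound) (use F in \<open>auto simp: bounded_linear_Blinfun_apply[OF bl]\<close>)
    show "Blinfun F (ell1_unit i) = y i" for i
      unfolding bounded_linear_Blinfun_apply[OF bl] F_def
      by (subst suminf_finite[of "{i}"]) (auto simp: ell1_unit.rep_eq)
  qed
qed

lemma norm_ell1_unit: "norm (ell1_unit i) = 1"
  unfolding norm_ell1.rep_eq by (subst suminf_finite[of "{i}"]) (auto simp: ell1_unit.rep_eq)


section \<open>Strong measurability\<close>

text \<open>Convergence holds everywhere off a null set \<open>N\<close>, and completeness absorbs
  whatever \<open>f\<close> does on \<open>N\<close>.\<close>

lemma (in complete_measure) borel_measurable_AE_limit:
  fixes f :: "'a \<Rightarrow> 'b::metric_space"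
  assumes s: "\<And>n::nat. s n \<in> borel_measurable M" and lim: "AE x in M. (\<lambda>n. s n x) \<longlonglongrightarrow> f x"
  shows "f \<in> borel_measurable M"
proof -
  obtain N where N: "N \<in> null_sets M" "{x \<in> space M. \<not> (\<lambda>n. s n x) \<longlonglongrightarrow> f x} \<subseteq> N"
    using lim by (auto simp: eventually_ae_filter)
  \<comment> \<open>One constant value on \<open>N\<close>, for \<open>g\<close> and for all
    approximants, turns a.e. convergence into convergence at every point.\<close>
  define g where "g x = (if x \<in> N then undefined else f x)" for x
  have g: "g \<in> borel_measurable M"
  proof (rule borel_measurable_LIMSEQ_metric)
    show "(\<lambda>x. if x \<in> N then undefined else s n x) \<in> borel_measurable M" for n
      using N(1) by (intro measurable_If_set s) auto
    show "(\<lambda>n. if x \<in> N then undefined else s n x) \<longlonglongrightarrow> g x" if "x \<in> space M" for x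
      using that N(2) by (auto simp: g_def)
  qed
  have "AE x in M. f x = g x"
    using AE_not_in[OF N(1)] by eventually_elim (simp add: g_def)
  show ?thesis
  proof (rule measurableI)
    fix B :: "'b set" assume "B \<in> sets borel"
    show "f -` B \<inter> space M \<in> sets M"
    \<comment> \<open>Completeness enters here: a set that agrees a.e. with a measurable set is
      measurable.\<close>
    proof (rule in_sets_AE)
      show "AE x in M. (x \<in> g -` B \<inter> space M) = (x \<in> f -` B \<inter> space M)"
        using \<open>AE x in M. f x = g x\<close> by eventually_elim simp
    qed (use measurable_sets[OF g \<open>B \<in> sets borel\<close>] in auto)
  qed simp
qed

lemma (in complete_measure) L0_borel_measurable:
  fixes f :: "'a \<Rightarrow> 'b::real_normed_vector"
  assumes "f \<in> L0 M"
  shows "f \<in> borel_measurable M"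
  using assms unfolding L0_def
  by (auto intro: borel_measurable_AE_limit borel_measurable_simple_function)

lemma L0_diff:
  fixes f g :: "'a \<Rightarrow> 'b::real_normed_vector"
  assumes "f \<in> L0 M" "g \<in> L0 M"
  shows "(\<lambda>x. f x - g x) \<in> L0 M"
proof -
  obtain s t where s: "\<And>n::nat. simple_function M (s n)" "AE x in M. (\<lambda>n. s n x) \<longlonglongrightarrow> f x"
    and t: "\<And>n::nat. simple_function M (t n)" "AE x in M. (\<lambda>n. t n x) \<longlonglongrightarrow> g x"
    using assms unfolding L0_def by auto
  have "AE x in M. (\<lambda>n. s n x - t n x) \<longlonglongrightarrow> f x - g x"
    using s(2) t(2) by eventually_elim (rule tendsto_diff)
  with simple_function_compose2[OF s(1) t(1)] show ?thesis
    unfolding L0_def by (intro CollectI exI[of _ "\<lambda>n x. s n x - t n x"]) auto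
qed

text \<open>A null set of the restriction is a Lebesgue null set inside \<open>S\<close>, so
  completeness is inherited.\<close>

lemma complete_measure_lebesgue_on:
  assumes "S \<in> sets lebesgue"
  shows "complete_measure (lebesgue_on S)"
proof
  fix A B :: "'a set"
  assume "A \<subseteq> B" "B \<in> null_sets (lebesgue_on S)"
  then have "B \<in> null_sets lebesgue" "A \<subseteq> S"
    using assms by (auto simp: null_sets_restrict_space)
  with \<open>A \<subseteq> B\<close> have "A \<in> sets lebesgue"
    by (meson completion.complete2 null_setsD2)
  with \<open>A \<subseteq> S\<close> show "A \<in> sets (lebesgue_on S)"
    using assms by (simp add: sets_restrict_space_iff)
qed


section \<open>Uniform convergence on the dual ball\<close>

lemma borel_measurable_blinfun_apply:
  fixes \<phi> :: "'b::real_normed_vector \<Rightarrow>\<^sub>L 'c::real_normed_vector"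
  assumes "f \<in> borel_measurable M"
  shows "(\<lambda>x. \<phi> (f x)) \<in> borel_measurable M"
  by (rule borel_measurable_continuous_on[OF _ assms]) (intro continuous_intros)

lemma (in finite_measure) tendsto_in_measure_iff:
  "tendsto_in_measure M g h \<longleftrightarrow> (\<forall>\<epsilon>>0. (\<lambda>n. measure M {x \<in> space M. \<epsilon> \<le> \<bar>g n x - h x\<bar>}) \<longlonglongrightarrow> 0)"
  by (simp add: tendsto_in_measure_def emeasure_eq_measure ennreal_0[symmetric] tendsto_ennreal_iff
      del: ennreal_0)

section \<open>Heads, tails and the gliding hump over a finite measure\<close>

context finite_measure
begin

text \<open>For one fixed function the tails decrease pointwise to 0, so the exceptional sets
  decrease to the empty set and continuity from above applies.\<close>

lemma ell1_tail_small:
  assumes f: "f \<in> borel_measurable M" and "\<epsilon> > 0" "\<delta> > 0"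
  shows "\<exists>N0. \<forall>N\<ge>N0. measure M {x \<in> space M. \<epsilon> \<le> norm (f x) - (\<Sum>i<N. \<bar>ell1_nth (f x) i\<bar>)} < \<delta>"
proof -
  define A where "A N = {x \<in> space M. \<epsilon> \<le> norm (f x) - (\<Sum>i<N. \<bar>ell1_nth (f x) i\<bar>)}" for N
  have [measurable]: "(\<lambda>x. ell1_nth (f x) i) \<in> borel_measurable M" for i
    by (rule borel_measurable_continuous_on[OF _ f])
      (intro linear_continuous_on bounded_linear_ell1_nth)
  have [measurable]: "(\<lambda>x. norm (f x)) \<in> borel_measurable M"
    using f by measurable
  have "A N \<in> sets M" for N
    unfolding A_def by measurable
  moreover have "decseq A"
    by (rule decseq_SucI) (auto simp: A_def)
  ultimately have "(\<lambda>N. measure M (A N)) \<longlonglongrightarrow> measure M (\<Inter>N. A N)"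
    by (intro finite_Lim_measure_decseq) auto
  moreover have "(\<Inter>N. A N) = {}"
  proof (intro equals0I)
    fix x assume "x \<in> (\<Inter>N. A N)"
    then have "\<epsilon> \<le> norm (f x) - (\<Sum>i<N. \<bar>ell1_nth (f x) i\<bar>)" for N
      by (auto simp: A_def)
    then have "\<epsilon> \<le> 0"
      by (intro LIMSEQ_le_const[OF tail_tendsto_0[of "f x"]]) auto
    with \<open>\<epsilon> > 0\<close> show False by simp
  qed
  ultimately have "(\<lambda>N. measure M (A N)) \<longlonglongrightarrow> 0"
    by simp
  from order_tendstoD(2)[OF this \<open>\<delta> > 0\<close>] show ?thesis
    by (simp add: eventually_sequentially A_def)
qed

text \<open>Coordinates are functionals, so each tends to 0 in measure, and a head involves only
  finitely many of them.\<close>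

lemma ell1_head_small:
  fixes f :: "nat \<Rightarrow> 'a \<Rightarrow> ell1"
  assumes f: "\<And>n. f n \<in> borel_measurable M" and null: "scalarly_null_in_measure M f"
    and "\<epsilon> > 0" "\<delta> > 0"
  shows "\<exists>n0. \<forall>n\<ge>n0. measure M {x \<in> space M. \<epsilon> \<le> (\<Sum>i<N. \<bar>ell1_nth (f n x) i\<bar>)} < \<delta>"
proof -
  \<comment> \<open>If all \<open>N\<close> coordinates are below \<open>\<eta>\<close>, their sum
    is at most \<open>N * \<eta>\<close>, which is strictly below \<open>\<epsilon>\<close>;
    \<open>Suc N\<close> also covers \<open>N = 0\<close>.\<close>
  define \<eta> where "\<eta> = \<epsilon> / real (Suc N)"
  have "\<eta> > 0" using \<open>\<epsilon> > 0\<close> by (simp add: \<eta>_def)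
  define A where "A i n = {x \<in> space M. \<eta> \<le> \<bar>ell1_nth (f n x) i\<bar>}" for i n
  have [measurable]: "(\<lambda>x. ell1_nth (f n x) i) \<in> borel_measurable M" for i n
    by (rule borel_measurable_continuous_on[OF _ f])
      (intro linear_continuous_on bounded_linear_ell1_nth)
  have meas: "A i n \<in> sets M" for i n
    unfolding A_def by measurable
  have "(\<lambda>n. measure M (A i n)) \<longlonglongrightarrow> 0" for i
    using null[unfolded scalarly_converges_in_measure_def, rule_format,
        of "Blinfun (\<lambda>x. ell1_nth x i)"] \<open>\<eta> > 0\<close>
    by (simp add: tendsto_in_measure_iff A_def zero_ell1.rep_eq
        bounded_linear_Blinfun_apply[OF bounded_linear_ell1_nth])
  then have "(\<lambda>n. \<Sum>i<N. measure M (A i n)) \<longlonglongrightarrow> 0"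
    by (intro tendsto_null_sum)
  from order_tendstoD(2)[OF this \<open>\<delta> > 0\<close>] obtain n0
    where n0: "\<And>n. n \<ge> n0 \<Longrightarrow> (\<Sum>i<N. measure M (A i n)) < \<delta>"
    by (auto simp: eventually_sequentially)
  have "measure M {x \<in> space M. \<epsilon> \<le> (\<Sum>i<N. \<bar>ell1_nth (f n x) i\<bar>)} < \<delta>" if "n \<ge> n0" for n
  proof -
    have "{x \<in> space M. \<epsilon> \<le> (\<Sum>i<N. \<bar>ell1_nth (f n x) i\<bar>)} \<subseteq> (\<Union>i<N. A i n)"
    proof (rule subsetI, rule ccontr)
      fix x assume x: "x \<in> {x \<in> space M. \<epsilon> \<le> (\<Sum>i<N. \<bar>ell1_nth (f n x) i\<bar>)}" "x \<notin> (\<Union>i<N. A i n)"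
      have "(\<Sum>i<N. \<bar>ell1_nth (f n x) i\<bar>) \<le> real (card {..<N}) * \<eta>"
        by (rule sum_bounded_above) (use x in \<open>force simp: A_def\<close>)
      also have "\<dots> < \<epsilon>"
        using \<open>\<epsilon> > 0\<close> by (simp add: \<eta>_def field_simps)
      finally show False using x by simp
    qed
    then have "measure M {x \<in> space M. \<epsilon> \<le> (\<Sum>i<N. \<bar>ell1_nth (f n x) i\<bar>)} \<le> measure M (\<Union>i<N. A i n)"
      by (rule finite_measure_mono) (use meas in auto)
    also have "\<dots> \<le> (\<Sum>i<N. measure M (A i n))"
      by (rule finite_measure_subadditive_finite) (use meas in auto)
    also have "\<dots> < \<delta>" by (rule n0) fact
    finally show ?thesis .
  qed
  then show ?thesis by blast
qed

text \<open>The index \<open>n0\<close> is chosen before \<open>\<phi>\<close>. This uniformity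
  replaces a diagonal argument over a countable dense set of functionals, since the dual of ell1 is
  not separable.\<close>

lemma gliding_hump:
  fixes f :: "nat \<Rightarrow> 'a \<Rightarrow> ell1"
  assumes f: "\<And>n. f n \<in> borel_measurable M" and null: "scalarly_null_in_measure M f"
    and "\<epsilon> > 0" "\<delta> > 0"
  shows "\<exists>n0. \<forall>n\<ge>n0. \<forall>\<phi> :: ell1 \<Rightarrow>\<^sub>L real. norm \<phi> \<le> 1 \<longrightarrow>
    measure M {x \<in> space M. \<epsilon> \<le> \<bar>blinfun_apply \<phi> (f n x)\<bar>} \<le> \<delta>"
proof (rule ccontr)
  assume "\<not> ?thesis"
  then have ex: "\<exists>n\<ge>n0. \<exists>\<phi> :: ell1 \<Rightarrow>\<^sub>L real. norm \<phi> \<le> 1 \<and>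
      \<delta> < measure M {x \<in> space M. \<epsilon> \<le> \<bar>blinfun_apply \<phi> (f n x)\<bar>}" for n0
    by (force simp: not_le)
  \<comment> \<open>Head and tail together stay below \<open>\<epsilon> / 4\<close> off the
    exceptional sets. Two functionals in the unit ball differ by norm at most 2, so gluing costs
    less than \<open>\<epsilon> / 2\<close>. Two exceptional sets of measure below
    \<open>\<delta> / 4\<close> leave \<open>\<delta> / 2\<close> of the original
    \<open>\<delta>\<close>.\<close>
  define head where "head N n = {x \<in> space M. \<epsilon> / 8 \<le> (\<Sum>i<N. \<bar>ell1_nth (f n x) i\<bar>)}" for N n
  define tail where
    "tail N n = {x \<in> space M. \<epsilon> / 8 \<le> norm (f n x) - (\<Sum>i<N. \<bar>ell1_nth (f n x) i\<bar>)}" for N n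
  \<comment> \<open>A state holds an index \<open>n\<close>, the right end \<open>N\<close> of its
    block and a bad functional. \<open>N\<close> is chosen after \<open>n\<close> to make the tail
    of \<open>f n\<close> small; \<open>Q\<close> then asks for a later index \<open>n'\<close>
    whose head up to the old \<open>N\<close> is small.\<close>
  define P where "P = (\<lambda>(n, N, \<phi> :: ell1 \<Rightarrow>\<^sub>L real). norm \<phi> \<le> 1 \<and>
      \<delta> < measure M {x \<in> space M. \<epsilon> \<le> \<bar>blinfun_apply \<phi> (f n x)\<bar>} \<and> measure M (tail N n) < \<delta> / 4)"
  define Q where "Q = (\<lambda>(n, N, \<phi> :: ell1 \<Rightarrow>\<^sub>L real) (n', N', \<phi>' :: ell1 \<Rightarrow>\<^sub>L real).
      n < n' \<and> N < N' \<and> measure M (head N n') < \<delta> / 4)"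
  have step: "\<exists>n N \<phi>. n0 \<le> n \<and> N0 \<le> N \<and> P (n, N, \<phi>)" for n0 N0
  proof -
    obtain n \<phi> where n: "n \<ge> n0" "norm (\<phi> :: ell1 \<Rightarrow>\<^sub>L real) \<le> 1"
        "\<delta> < measure M {x \<in> space M. \<epsilon> \<le> \<bar>blinfun_apply \<phi> (f n x)\<bar>}"
      using ex by blast
    obtain N1 where "\<And>N. N \<ge> N1 \<Longrightarrow> measure M (tail N n) < \<delta> / 4"
      using ell1_tail_small[OF f, of "\<epsilon> / 8" "\<delta> / 4" n] assms(3,4) by (auto simp: tail_def)
    then have "P (n, max N0 N1, \<phi>)"
      using n by (simp add: P_def)
    with n(1) show ?thesis by (intro exI[of _ n] exI[of _ "max N0 N1"] exI[of _ \<phi>]) auto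
  qed
  have "\<exists>h. \<forall>k. P (h k) \<and> Q (h k) (h (Suc k))"
  proof (rule dependent_nat_choice)
    show "\<exists>x. P x" using step by blast
    fix x and k :: nat assume "P x"
    obtain n N \<phi> where x: "x = (n, N, \<phi>)" by (cases x)
    obtain n1 where "\<And>n'. n' \<ge> n1 \<Longrightarrow> measure M (head N n') < \<delta> / 4"
      using ell1_head_small[OF f null, of "\<epsilon> / 8" "\<delta> / 4" N] assms(3,4) by (auto simp: head_def)
    moreover obtain n' N' \<phi>' where "max (Suc n) n1 \<le> n'" "Suc N \<le> N'" "P (n', N', \<phi>')"
      using step by blast
    ultimately show "\<exists>y. P y \<and> Q x y"
      by (intro exI[of _ "(n', N', \<phi>')"]) (auto simp: Q_def x)
  qed
  then obtain h where h: "\<And>k. P (h k)" "\<And>k. Q (h k) (h (Suc k))"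
    by blast
  define n N \<phi> where "n k = fst (h k)" and "N k = fst (snd (h k))" and "\<phi> k = snd (snd (h k))" for k
  have h_eq: "h k = (n k, N k, \<phi> k)" for k
    by (simp add: n_def N_def \<phi>_def)
  have \<phi>: "norm (\<phi> k) \<le> 1" "\<delta> < measure M {x \<in> space M. \<epsilon> \<le> \<bar>\<phi> k (f (n k) x)\<bar>}"
    and tail: "measure M (tail (N k) (n k)) < \<delta> / 4" for k
    using h(1)[of k] by (auto simp: P_def h_eq)
  have n_less: "n k < n (Suc k)" and N_less: "N k < N (Suc k)"
    and head: "measure M (head (N k) (n (Suc k))) < \<delta> / 4" for k
    using h(2)[of k] by (auto simp: Q_def h_eq)
  have "strict_mono n" "strict_mono N"
    using n_less N_less by (auto simp: strict_mono_Suc_iff)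

  text \<open>Glue the functionals: on the block \<open>[N k, N (k + 1))\<close> the coordinates of \<open>\<psi>\<close> are those of
    \<open>\<phi> (k + 1)\<close>.\<close>
  define j where "j i = (LEAST k. i < N k)" for i
  \<comment> \<open>Coordinates below \<open>N 0\<close> get \<open>j i = 0\<close>. They belong to
    the head of every later block, so the head estimate covers them.\<close>
  have j: "j i = Suc k" if "N k \<le> i" "i < N (Suc k)" for i k
    unfolding j_def
  proof (rule Least_equality)
    fix m assume "i < N m"
    then have "N k < N m" using that by simp
    then show "Suc k \<le> m"
      using \<open>strict_mono N\<close> by (simp add: strict_mono_less Suc_le_eq)
  qed fact
  have "\<bar>\<phi> (j i) (ell1_unit i)\<bar> \<le> 1" for i
    using norm_blinfun[of "\<phi> (j i)" "ell1_unit i"] \<phi>(1)[of "j i"] by (simp add: norm_ell1_unit)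
  then obtain \<psi> :: "ell1 \<Rightarrow>\<^sub>L real" where \<psi>: "norm \<psi> \<le> 1" "\<And>i. \<psi> (ell1_unit i) = \<phi> (j i) (ell1_unit i)"
    using ex_blinfun_ell1_unit[of "\<lambda>i. \<phi> (j i) (ell1_unit i)"] by metis
  define B where "B m = {x \<in> space M. \<epsilon> / 2 \<le> \<bar>\<psi> (f m x)\<bar>}" for m
  note [measurable] = borel_measurable_blinfun_apply[OF f]
  have [measurable]: "(\<lambda>x. ell1_nth (f n x) i) \<in> borel_measurable M" for i n
    by (rule borel_measurable_continuous_on[OF _ f])
      (intro linear_continuous_on bounded_linear_ell1_nth)
  have [measurable]: "(\<lambda>x. norm (f n x)) \<in> borel_measurable M" for n
    using f by measurable
  have meas: "B m \<in> sets M" "head K m \<in> sets M" "tail K m \<in> sets M" for m K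
    unfolding B_def head_def tail_def by measurable
  \<comment> \<open>Off head and tail, \<open>\<psi>\<close> differs from
    \<open>\<phi> (Suc k)\<close> by less than \<open>\<epsilon> / 2\<close>, so a value of size
    \<open>\<epsilon>\<close> forces \<open>\<psi>\<close> to be at least
    \<open>\<epsilon> / 2\<close> in modulus.\<close>
  have B_ge: "\<delta> / 2 \<le> measure M (B (n (Suc k)))" for k
  proof -
    let ?n = "n (Suc k)"
    have "{x \<in> space M. \<epsilon> \<le> \<bar>\<phi> (Suc k) (f ?n x)\<bar>} \<subseteq> (B ?n \<union> head (N k) ?n) \<union> tail (N (Suc k)) ?n"
    proof (rule subsetI, rule ccontr)
      fix x assume x: "x \<in> {x \<in> space M. \<epsilon> \<le> \<bar>\<phi> (Suc k) (f ?n x)\<bar>}"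
        "x \<notin> (B ?n \<union> head (N k) ?n) \<union> tail (N (Suc k)) ?n"
      let ?R = "(\<Sum>i<N k. \<bar>ell1_nth (f ?n x) i\<bar>) + (norm (f ?n x) - (\<Sum>i<N (Suc k). \<bar>ell1_nth (f ?n x) i\<bar>))"
      have R: "?R < \<epsilon> / 4" "\<bar>\<psi> (f ?n x)\<bar> < \<epsilon> / 2"
        using x by (auto simp: head_def tail_def B_def)
      have "0 \<le> ?R"
        using sum_le_norm_ell1[of "f ?n x" "N (Suc k)"] by (simp add: sum_nonneg)
      have "norm (\<phi> (Suc k) - \<psi>) \<le> 2"
        using norm_triangle_ineq4[of "\<phi> (Suc k)" \<psi>] \<phi>(1)[of "Suc k"] \<psi>(1) by linarith
      have "\<bar>\<phi> (Suc k) (f ?n x) - \<psi> (f ?n x)\<bar> \<le> norm (\<phi> (Suc k) - \<psi>) * ?R"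
        by (rule blinfun_diff_le) (use N_less[of k] j \<psi>(2) in auto)
      also have "\<dots> \<le> 2 * ?R"
        by (rule mult_right_mono) fact+
      finally show False using R x(1) by auto
    qed
    then have "measure M {x \<in> space M. \<epsilon> \<le> \<bar>\<phi> (Suc k) (f ?n x)\<bar>}
        \<le> measure M ((B ?n \<union> head (N k) ?n) \<union> tail (N (Suc k)) ?n)"
      by (rule finite_measure_mono) (use meas in auto)
    also have "\<dots> \<le> measure M (B ?n \<union> head (N k) ?n) + measure M (tail (N (Suc k)) ?n)"
      by (rule measure_Un_le) (use meas in auto)
    also have "measure M (B ?n \<union> head (N k) ?n) \<le> measure M (B ?n) + measure M (head (N k) ?n)"
      by (rule measure_Un_le) (use meas in auto)
    finally show ?thesis
      using \<phi>(2)[of "Suc k"] tail[of "Suc k"] head[of k] by simp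
  qed
  have "(\<lambda>m. measure M (B m)) \<longlonglongrightarrow> 0"
    using null[unfolded scalarly_converges_in_measure_def tendsto_in_measure_iff, rule_format,
        of "\<epsilon> / 2" \<psi>] \<open>\<epsilon> > 0\<close>
    by (simp add: B_def)
  then have "(\<lambda>k. measure M (B (n (Suc k)))) \<longlonglongrightarrow> 0"
    using LIMSEQ_subseq_LIMSEQ[OF _ \<open>strict_mono n\<close>, THEN LIMSEQ_Suc] by (simp add: o_def)
  then have "\<delta> / 2 \<le> 0"
    by (rule LIMSEQ_le_const) (use B_ge in auto)
  with \<open>\<delta> > 0\<close> show False by simp
qed

section \<open>Extraction of one subsequence that serves all functionals\<close>

lemma scalarly_null_ae_subseq:
  fixes f :: "nat \<Rightarrow> 'a \<Rightarrow> ell1"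
  assumes f: "\<And>n. f n \<in> borel_measurable M" and null: "scalarly_null_in_measure M f"
  obtains r :: "nat \<Rightarrow> nat" where "strict_mono r" "scalarly_null_ae M (f \<circ> r)"
proof -
  \<comment> \<open>The same \<open>(1/2)^k\<close> serves twice: as a threshold it tends to 0, and
    as a bound on measures it is summable, as Borel-Cantelli requires.\<close>
  define P where "P k n \<longleftrightarrow> (\<forall>\<phi> :: ell1 \<Rightarrow>\<^sub>L real. norm \<phi> \<le> 1 \<longrightarrow>
    measure M {x \<in> space M. (1/2)^k \<le> \<bar>blinfun_apply \<phi> (f n x)\<bar>} \<le> (1/2)^k)" for k :: nat and n
  have ev: "\<exists>n0. \<forall>n\<ge>n0. P k n" for k
    using gliding_hump[OF f null, of "(1/2)^k" "(1/2)^k"] by (simp add: P_def)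
  have "\<exists>r. \<forall>k. P k (r k) \<and> r k < r (Suc k)"
  proof (rule dependent_nat_choice)
    show "\<exists>x. P 0 x" using ev by blast
    fix x k
    obtain n0 where "\<forall>n\<ge>n0. P (Suc k) n" using ev by blast
    then show "\<exists>y. P (Suc k) y \<and> x < y"
      by (intro exI[of _ "max n0 (Suc x)"]) auto
  qed
  then obtain r where r: "\<And>k. P k (r k)" "\<And>k. r k < r (Suc k)"
    by blast
  have unit: "AE x in M. (\<lambda>k. \<phi> (f (r k) x)) \<longlonglongrightarrow> 0" if "norm \<phi> \<le> 1" for \<phi> :: "ell1 \<Rightarrow>\<^sub>L real"
  proof -
    define A where "A k = {x \<in> space M. (1/2)^k \<le> \<bar>\<phi> (f (r k) x)\<bar>}" for k
    note [measurable] = borel_measurable_blinfun_apply[OF f]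
    have "AE x in M. eventually (\<lambda>k. x \<in> space M - A k) sequentially"
    proof (rule borel_cantelli_AE1)
      show "A k \<in> sets M" for k unfolding A_def by measurable
      show "summable (\<lambda>k. measure M (A k))"
      proof (rule summable_comparison_test'[of "\<lambda>k. (1/2)^k" 0])
        show "norm (measure M (A k)) \<le> (1/2)^k" for k
          using r(1)[of k] that by (simp add: P_def A_def)
      qed (simp add: summable_geometric)
    qed (simp add: emeasure_eq_measure)
    then show ?thesis
    proof eventually_elim
      case (elim x)
      show ?case
      proof (rule Lim_null_comparison)
        show "eventually (\<lambda>k. norm (\<phi> (f (r k) x)) \<le> (1/2)^k) sequentially"
          using elim by eventually_elim (auto simp: A_def)
        show "(\<lambda>k. (1/2::real)^k) \<longlonglongrightarrow> 0"
          by (rule LIMSEQ_power_zero) simp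
      qed
    qed
  qed
  have "AE x in M. (\<lambda>k. \<phi> (f (r k) x)) \<longlonglongrightarrow> 0" for \<phi> :: "ell1 \<Rightarrow>\<^sub>L real"
  proof -
    \<comment> \<open>Adding 1 keeps \<open>c\<close> positive for \<open>\<phi> = 0\<close>, so
      dividing by \<open>c\<close> always gives a functional in the unit ball.\<close>
    define c where "c = norm \<phi> + 1"
    have c: "c > 0" by (simp add: c_def add_nonneg_pos)
    have "norm (\<phi> /\<^sub>R c) \<le> 1"
      using c by (simp add: c_def field_simps)
    from unit[OF this] show ?thesis
    proof eventually_elim
      case (elim x)
      from tendsto_mult[OF tendsto_const[of c] this] show ?case
        using c by (simp add: blinfun.scaleR_left field_simps)
    qed
  qed
  then show thesis
    using r(2) that[of r] by (simp add: strict_mono_Suc_iff scalarly_converges_ae_def)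
qed

end

section \<open>Lebesgue measure on the unit interval and property (D_p)\<close>

theorem theorem3p6:
  shows "(\<forall>f :: nat \<Rightarrow> real \<Rightarrow> ell1.
            (\<forall>n. f n \<in> L0 Omega) \<and> scalarly_null_in_measure Omega f \<longrightarrow>
            (\<exists>r :: nat \<Rightarrow> nat. strict_mono r \<and> scalarly_null_ae Omega (f \<circ> r)))
       \<and> (\<forall>p :: ennreal. 1 \<le> p \<longrightarrow> property_D p TYPE(ell1))"
proof -
  interpret complete_measure Omega
    by (rule complete_measure_lebesgue_on) simp
  interpret finite_measure Omega
    by (rule finite_measure_lebesgue_on) simp
  have main: "\<exists>r :: nat \<Rightarrow> nat. strict_mono r \<and> scalarly_null_ae Omega (f \<circ> r)"
    if "\<And>n. f n \<in> L0 Omega" "scalarly_null_in_measure Omega f" for f :: "nat \<Rightarrow> real \<Rightarrow> ell1"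
    using scalarly_null_ae_subseq[OF L0_borel_measurable[OF that(1)] that(2)] by blast
  have "property_D p TYPE(ell1)" for p
    unfolding property_D_def
  proof (intro allI impI, elim conjE)
    fix f :: "nat \<Rightarrow> real \<Rightarrow> ell1" and g
    assume "Lp_bounded p Omega f" and g: "g \<in> L0 Omega"
      and conv: "scalarly_converges_in_measure Omega f g"
    then have f: "f n \<in> L0 Omega" for n
      by (simp add: Lp_bounded_def)
    \<comment> \<open>Functionals are linear, so subtracting \<open>g\<close> reduces convergence to
      the null case, and adding it back transfers the a.e. conclusion.\<close>
    have "scalarly_null_in_measure Omega (\<lambda>n x. f n x - g x)"
      using conv
      by (simp add: scalarly_converges_in_measure_def tendsto_in_measure_def blinfun.diff_right)
    from main[OF L0_diff[OF f g] this] obtain r :: "nat \<Rightarrow> nat"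
      where r: "strict_mono r" "scalarly_null_ae Omega ((\<lambda>n x. f n x - g x) \<circ> r)"
      by blast
    then have "scalarly_converges_ae Omega (f \<circ> r) g"
      by (simp add: scalarly_converges_ae_def blinfun.diff_right LIM_zero_iff)
    with r(1) show "\<exists>r :: nat \<Rightarrow> nat. strict_mono r \<and> scalarly_converges_ae Omega (f \<circ> r) g"
      by blast
  qed
  with main show ?thesis by blast
qed

end
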